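(* Let $\alpha\in(0,1]$, let $\{X_t\}$ be a positive scalar latent position process, let $t,s$ be two times, and let $\mathbf{X}_t,\mathbf{X}_s\in\mathbb{R}^{n\times1}$ be the latent position matrices with $n$ rows drawn i.i.d. from this process. Let $\alpha_n=\lfloor\alpha n\rfloor$ and let $P_{n,\alpha}$ be the permutation matrix of an $\alpha$-shuffling, independent of the latent positions. Then for any $\epsilon>0$, $$\mathbb{P}\left(\left|\hat d^2_{MV}(\mathbf{X}_t,P_{n,\alpha}\mathbf{X}_s)-\left(\left(1-\frac{\alpha_n}{n}\right)d_{MV}^2(X_t,X_s)+\frac{\alpha_n}{n}\,\text{ind-}d_{MV}^2(X_t,X_s)\right)\right|\ge\epsilon\right)\le\frac{1}{(n-\alpha_n)\epsilon^2}+\frac{12}{\alpha_n\epsilon^2}+\frac{4}{\alpha_n\epsilon}.$$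
   Context: A positive scalar latent position process is a family of real random variables $X_t$ on a common probability space, with $X_t\ge 0$ and $0\le xy\le 1$ for all $x,y$ in the support of $X_t$; hence each $X_t$ takes values in $[0,1]$. Latent position matrices: draw $\omega_1,\dots,\omega_n$ i.i.d. from the probability space; the $j$th entry of $\mathbf{X}_t$ is $X_t(\omega_j)$, for every $t$ (so the pairs $((\mathbf{X}_t)_j,(\mathbf{X}_s)_j)$ are i.i.d. copies of $(X_t,X_s)$). $\alpha$-shuffling: let $\sigma_{\alpha_n}$ be a uniformly distributed random permutation of $\{n-\alpha_n+1,\dots,n\}$ with permutation matrix $P_{\alpha_n}$; the $\alpha$-shuffling is the $\sigma\in S_n$ with $\sigma(i)=i$ for $i\le n-\alpha_n$ and $\sigma(j)=\sigma_{\alpha_n}(j)$ for $j>n-\alpha_n$. Its permutation matrix is $P_{n,\alpha}=I_{n-\alpha_n}\oplus P_{\alpha_n}$. For $\mathbf{X},\mathbf{Y}\in\mathbb{R}^{n\times d}$, $\hat d_{MV}^2(\mathbf{X},\mathbf{Y})=\min_{W}\frac1n\|(\mathbf{X}-\mathbf{Y}W)^\top(\mathbf{X}-\mathbf{Y}W)\|_2$. For random vectors $X,Y$ in $\mathbb{R}^d$ on a common probability space, with laws $\mu_X,\mu_Y$, $d_{MV}(X,Y)=\min_W\|\mathbb{E}[(X-WY)(X-WY)^\top]\|_2^{1/2}$ and $\text{ind-}d_{MV}(X,Y)=\min_W\|\mathbb{E}_{(X',Y')\sim\mu_X\otimes\mu_Y}[(X'-WY')(X'-WY')^\top]\|_2^{1/2}$.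 All minima are over $d\times d$ real orthogonal matrices $W$, and $\|\cdot\|_2$ is the spectral norm (here $d=1$, so $W\in\{\pm1\}$). $d_{MV}^2$ and $\text{ind-}d_{MV}^2$ denote squares. Convention: a term on the right-hand side with zero denominator is $+\infty$ (the bound is then vacuous). *)

theory Defs
  imports "HOL-Probability.Probability" "HOL-Combinatorics.Permutations"
begin

text \<open>
  A matrix in \<open>\<real>\<^bsup>n\<times>d\<^esup>\<close> is represented by its rows, a function \<^typ>\<open>nat \<Rightarrow> real^'d\<close> of which only
  the values at \<open>1, \<dots>, n\<close> matter.

  All minima over orthogonal matrices are written as infima: the set of orthogonal matrices is
  compact and non-empty and the objectives are continuous in \<open>W\<close> (for the random vectors:
  whenever the second moments are finite), so the infima are attained.
\<close>

definition spectral_norm :: "real^'d^'d \<Rightarrow> real" where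
  "spectral_norm A = onorm (\<lambda>v. A *v v)"

definition outer :: "real^'d \<Rightarrow> real^'d^'d" where
  "outer v = (\<chi> k l. v $ k * v $ l)"

text \<open>\<open>Z\<^sup>T Z\<close> for an \<open>n \<times> d\<close> matrix \<open>Z\<close>:\<close>

definition gram :: "nat \<Rightarrow> (nat \<Rightarrow> real^'d) \<Rightarrow> real^'d^'d" where
  "gram n Z = (\<chi> k l. \<Sum>i=1..n. Z i $ k * Z i $ l)"

text \<open>The squared empirical distance; the \<open>i\<close>-th row of \<open>X - Y W\<close> is \<open>X i - Y i v* W\<close>.\<close>

definition dhat_MV_sq :: "nat \<Rightarrow> (nat \<Rightarrow> real^'d) \<Rightarrow> (nat \<Rightarrow> real^'d) \<Rightarrow> real" where
  "dhat_MV_sq n X Y =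
     (INF W\<in>{W :: real^'d^'d. orthogonal_matrix W}.
        1 / real n * spectral_norm (gram n (\<lambda>i. X i - Y i v* W)))"

definition d_MV :: "'a measure \<Rightarrow> ('a \<Rightarrow> real^'d) \<Rightarrow> ('a \<Rightarrow> real^'d) \<Rightarrow> real" where
  "d_MV M X Y =
     (INF W\<in>{W :: real^'d^'d. orthogonal_matrix W}.
        sqrt (spectral_norm (\<integral>\<omega>. outer (X \<omega> - W *v Y \<omega>) \<partial>M)))"

definition ind_d_MV :: "'a measure \<Rightarrow> ('a \<Rightarrow> real^'d) \<Rightarrow> ('a \<Rightarrow> real^'d) \<Rightarrow> real" where
  "ind_d_MV M X Y =
     (INF W\<in>{W :: real^'d^'d. orthogonal_matrix W}.
        sqrt (spectral_norm
          (\<integral>z. outer (fst z - W *v snd z) \<partial>(distr M borel X \<Otimes>\<^sub>M distr M borel Y))))"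

text \<open>The (closed, topological) support of the law of a random variable:\<close>

definition law_support :: "'a measure \<Rightarrow> ('a \<Rightarrow> real) \<Rightarrow> real set" where
  "law_support M X = {x. \<forall>U. open U \<longrightarrow> x \<in> U \<longrightarrow> 0 < measure (distr M borel X) U}"

definition positive_scalar_lpp :: "'a measure \<Rightarrow> ('t \<Rightarrow> 'a \<Rightarrow> real) \<Rightarrow> bool" where
  "positive_scalar_lpp M X \<longleftrightarrow>
     prob_space M \<and>
     (\<forall>t. X t \<in> borel_measurable M) \<and>
     (\<forall>t. AE \<omega> in M. 0 \<le> X t \<omega>) \<and>
     (\<forall>t. \<forall>x\<in>law_support M (X t). \<forall>y\<in>law_support M (X t). 0 \<le> x * y \<and> x * y \<le> 1)"

text \<open>\<open>w 1, \<dots>, w n\<close> are independent random elements of \<open>M\<close>, each with law \<open>M\<close>, defined on a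
  probability space \<open>N\<close>.\<close>

definition iid_draws :: "'b measure \<Rightarrow> 'a measure \<Rightarrow> nat \<Rightarrow> (nat \<Rightarrow> 'b \<Rightarrow> 'a) \<Rightarrow> bool" where
  "iid_draws N M n w \<longleftrightarrow>
     prob_space N \<and>
     prob_space.indep_vars N (\<lambda>_. M) w {1..n} \<and>
     (\<forall>j\<in>{1..n}. distr N M (w j) = M)"

text \<open>A one-dimensional random vector from a real random variable:\<close>

definition lift1 :: "('a \<Rightarrow> real) \<Rightarrow> 'a \<Rightarrow> real^1" where
  "lift1 Y = (\<lambda>\<omega>. vec (Y \<omega>))"

definition latent_matrix :: "('a \<Rightarrow> real) \<Rightarrow> (nat \<Rightarrow> 'b \<Rightarrow> 'a) \<Rightarrow> 'b \<Rightarrow> nat \<Rightarrow> real^1" where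
  "latent_matrix Y w \<xi> = (\<lambda>j. lift1 Y (w j \<xi>))"

text \<open>All latent positions \<open>X\<^sub>t(\<omega>\<^sub>j)\<close>, for \<open>j\<close> in \<open>{1..n}\<close> and every time \<open>t\<close>, as one random
  element of the product space \<^term>\<open>latent_space n\<close>.\<close>

definition latent_space :: "nat \<Rightarrow> (nat \<Rightarrow> 't \<Rightarrow> real) measure" where
  "latent_space n = (\<Pi>\<^sub>M j\<in>{1..n}. \<Pi>\<^sub>M t\<in>UNIV. borel)"

definition latent_positions ::
    "nat \<Rightarrow> ('t \<Rightarrow> 'a \<Rightarrow> real) \<Rightarrow> (nat \<Rightarrow> 'b \<Rightarrow> 'a) \<Rightarrow> 'b \<Rightarrow> nat \<Rightarrow> 't \<Rightarrow> real" where
  "latent_positions n X w \<xi> = (\<lambda>j\<in>{1..n}. \<lambda>t. X t (w j \<xi>))"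

text \<open>A function that \<open>permutes\<close> a set is the identity outside it, so these are exactly the
  permutations of \<open>{n - a + 1..n}\<close> extended by the identity.\<close>

definition shuffles_of_last :: "nat \<Rightarrow> nat \<Rightarrow> (nat \<Rightarrow> nat) set" where
  "shuffles_of_last n a = {p. p permutes {n - a + 1..n}}"

text \<open>The random permutation \<open>\<sigma>\<close> shuffles the last \<open>a\<close> of \<open>n\<close> indices uniformly.\<close>

definition uniform_shuffling :: "'b measure \<Rightarrow> nat \<Rightarrow> nat \<Rightarrow> ('b \<Rightarrow> nat \<Rightarrow> nat) \<Rightarrow> bool" where
  "uniform_shuffling N n a \<sigma> \<longleftrightarrow>
     \<sigma> \<in> N \<rightarrow>\<^sub>M count_space (shuffles_of_last n a) \<and>
     distr N (count_space (shuffles_of_last n a)) \<sigma> = uniform_count_measure (shuffles_of_last n a)"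

text \<open>Permutation matrix with \<open>P e\<^sub>j = e\<^bsub>p j\<^esub>\<close>, and the product of an \<open>n \<times> n\<close> with an
  \<open>n \<times> d\<close> matrix:\<close>

definition perm_matrix :: "(nat \<Rightarrow> nat) \<Rightarrow> nat \<Rightarrow> nat \<Rightarrow> real" where
  "perm_matrix p i j = (if i = p j then 1 else 0)"

definition mat_mult_rows :: "nat \<Rightarrow> (nat \<Rightarrow> nat \<Rightarrow> real) \<Rightarrow> (nat \<Rightarrow> real^'d) \<Rightarrow> nat \<Rightarrow> real^'d" where
  "mat_mult_rows n P X = (\<lambda>i. \<Sum>j=1..n. P i j *\<^sub>R X j)"

text \<open>Independence of two random elements whose values may have different types (the library's
  \<open>indep_var\<close> needs a common type): the generated \<open>\<sigma>\<close>-algebras are independent.\<close>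

definition indep_elements ::
    "'b measure \<Rightarrow> 'c measure \<Rightarrow> ('b \<Rightarrow> 'c) \<Rightarrow> 'd measure \<Rightarrow> ('b \<Rightarrow> 'd) \<Rightarrow> bool" where
  "indep_elements N S f T g \<longleftrightarrow>
     f \<in> N \<rightarrow>\<^sub>M S \<and> g \<in> N \<rightarrow>\<^sub>M T \<and>
     prob_space.indep_set N (sets (vimage_algebra (space N) f S)) (sets (vimage_algebra (space N) g T))"

end

theory Submission
  imports Defs
begin

text \<open>
  In dimension one the orthogonal matrices are \<open>1\<close> and \<open>-1\<close>, and for nonnegative positions the
  sign \<open>1\<close> is optimal in all three distances. So the empirical distance is almost surely the
  average of \<open>(x\<^sub>i - y\<^bsub>q i\<^esub>)\<^sup>2\<close> with \<open>q = \<sigma>\<inverse>\<close>, the squared distance \<open>d\<^sub>M\<^sub>V\<^sup>2\<close> is the mean \<open>\<mu>\<close> of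
  \<open>(x\<^sub>i - y\<^sub>i)\<^sup>2\<close>, and its independent version is the mean \<open>\<nu>\<close> of \<open>(x\<^sub>i - y\<^sub>k)\<^sup>2\<close> for \<open>i \<noteq> k\<close>.
  The support condition forces all positions into \<open>[0, 1]\<close>, so every summand lies in \<open>[0, 1]\<close>.

  Let \<open>a = \<alpha>\<^sub>n\<close>, fix the permutation, and subtract \<open>\<mu>\<close> from each of the first \<open>n - a\<close> summands
  and \<open>\<nu>\<close> from each of the last \<open>a\<close>. The resulting \<open>c\<^sub>i\<close> is centred unless \<open>i\<close> is a fixed point of
  \<open>q\<close> in the shuffled block, and \<open>c\<^sub>i\<close>, \<open>c\<^sub>j\<close> are independent when \<open>{i, q i}\<close> and \<open>{j, q j}\<close> are
  disjoint. Hence \<open>c\<^sub>i c\<^sub>j\<close> has mean zero except on the diagonal, for \<open>j = q i\<close> or \<open>i = q j\<close> inside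
  the block, or when \<open>i\<close> and \<open>j\<close> are both fixed points in the block. With \<open>F\<close> fixed points there
  are at most \<open>n + 2a + aF\<close> such pairs, each contributing at most \<open>1\<close>, and Chebyshev's
  inequality bounds the conditional probability by \<open>(n + 2a + aF) / (n \<epsilon>)\<^sup>2\<close>
  (lemma \<open>matched_block_deviation\<close>).

  The shuffle is independent of the positions, so the probability is the average of these
  conditional ones (lemma \<open>prob_le_sum_prob_indep\<close>). A uniform permutation has one fixed point on
  average (lemma \<open>sum_card_fixed_points\<close>), which leaves
  \<open>((n - a) + 4a) / (n \<epsilon>)\<^sup>2 \<le> 1 / ((n - a) \<epsilon>\<^sup>2) + 4 / (a \<epsilon>\<^sup>2)\<close>.
  This is smaller than the asserted bound.
\<close>

section \<open>Scalar form of the matching distances\<close>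

lemma orthogonal_matrix_1_iff:
  fixes W :: "real^1^1"
  shows "orthogonal_matrix W \<longleftrightarrow> W = mat 1 \<or> W = - mat 1"
proof -
  have "orthogonal_matrix W \<longleftrightarrow> W $ 1 $ 1 * W $ 1 $ 1 = 1"
    by (simp add: orthogonal_matrix vec_eq_iff forall_1 matrix_matrix_mult_def transpose_def mat_def)
  also have "\<dots> \<longleftrightarrow> W $ 1 $ 1 = 1 \<or> W $ 1 $ 1 = -1"
    by (rule square_eq_1_iff)
  also have "\<dots> \<longleftrightarrow> W = mat 1 \<or> W = - mat 1"
    by (simp add: vec_eq_iff forall_1 mat_def)
  finally show ?thesis .
qed

lemma INF_orthogonal_matrix_1:
  fixes h :: "real^1^1 \<Rightarrow> real"
  assumes "h (mat 1) \<le> h (- mat 1)"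
  shows "(INF W\<in>{W. orthogonal_matrix W}. h W) = h (mat 1)"
  by (rule cInf_eq_minimum) (use assms in \<open>auto simp: orthogonal_matrix_1_iff\<close>)

lemma spectral_norm_1:
  fixes A :: "real^1^1"
  shows "spectral_norm A = \<bar>A $ 1 $ 1\<bar>"
proof -
  have "(\<lambda>v. A *v v) = (\<lambda>v. (A $ 1 $ 1) *\<^sub>R v)"
    by (simp add: fun_eq_iff vec_eq_iff forall_1 matrix_vector_mult_def)
  then show ?thesis
    unfolding spectral_norm_def
    by (simp add: onorm_scaleR[OF bounded_linear_ident] onorm_id)
qed

lemma outer_1: "outer (v :: real^1) = (v $ 1)\<^sup>2 *\<^sub>R mat 1"
  by (simp add: outer_def vec_eq_iff forall_1 mat_def power2_eq_square)

lemma integral_outer_1: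
  fixes Z :: "'a \<Rightarrow> real^1"
  assumes "integrable L (\<lambda>z. (Z z $ 1)\<^sup>2)"
  shows "spectral_norm (\<integral>z. outer (Z z) \<partial>L) = (\<integral>z. (Z z $ 1)\<^sup>2 \<partial>L)"
proof -
  have "(\<integral>z. outer (Z z) \<partial>L) = (\<integral>z. (Z z $ 1)\<^sup>2 \<partial>L) *\<^sub>R (mat 1 :: real^1^1)"
    unfolding outer_1 using assms by (intro integral_scaleR_left)
  then show ?thesis
    by (simp add: spectral_norm_1 mat_def)
qed

text \<open>This is why the sign \<open>1\<close> is the best alignment of nonnegative positions.\<close>

lemma square_diff_le_square_sum:
  fixes x y :: real
  assumes "0 \<le> x" "0 \<le> y"
  shows "(x - y)\<^sup>2 \<le> (x + y)\<^sup>2"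
  using assms by (intro power2_le_iff_abs_le[THEN iffD2]) auto

lemma dhat_MV_sq_nonneg_scalar:
  assumes "\<And>i. i \<in> {1..n} \<Longrightarrow> 0 \<le> A i $ 1 \<and> 0 \<le> B i $ 1"
  shows "dhat_MV_sq n A B = (\<Sum>i=1..n. (A i $ 1 - B i $ (1::1))\<^sup>2) / real n"
proof -
  let ?h = "\<lambda>W :: real^1^1. 1 / real n * spectral_norm (gram n (\<lambda>i. A i - B i v* W))"
  have p: "?h (mat 1) = (\<Sum>i=1..n. (A i $ 1 - B i $ 1)\<^sup>2) / real n"
    by (simp add: spectral_norm_1 gram_def power2_eq_square sum_nonneg)
  have m: "?h (- mat 1) = (\<Sum>i=1..n. (A i $ 1 + B i $ 1)\<^sup>2) / real n"
    by (simp add: spectral_norm_1 gram_def power2_eq_square sum_nonneg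
        vector_matrix_mult_def mat_def)
  have "?h (mat 1) \<le> ?h (- mat 1)"
    unfolding p m using assms
    by (intro divide_right_mono sum_mono square_diff_le_square_sum) auto
  then show ?thesis
    unfolding dhat_MV_sq_def using p by (simp only: INF_orthogonal_matrix_1)
qed

text \<open>The two population distances differ only in the measure and in the pair of random vectors
  (\<open>X\<close> and \<open>Y\<close> on \<open>M\<close>, or the two projections on the product of the laws). This lemma
  evaluates both. The upper bound \<open>1\<close> makes the squares integrable, which matters because a
  non-integrable function has integral \<open>0\<close>.\<close>

lemma INF_sqrt_second_moment_1:
  fixes F G :: "'a \<Rightarrow> real^1"
  assumes "prob_space L"
    and [measurable]: "(\<lambda>z. F z $ 1) \<in> borel_measurable L" "(\<lambda>z. G z $ 1) \<in> borel_measurable L"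
    and AE: "AE z in L. F z $ 1 \<in> {0..1} \<and> G z $ 1 \<in> {0..1}"
  shows "(INF W\<in>{W :: real^1^1. orthogonal_matrix W}.
            sqrt (spectral_norm (\<integral>z. outer (F z - W *v G z) \<partial>L)))\<^sup>2
         = (\<integral>z. (F z $ 1 - G z $ 1)\<^sup>2 \<partial>L)"
proof -
  interpret prob_space L by fact
  let ?h = "\<lambda>W :: real^1^1. sqrt (spectral_norm (\<integral>z. outer (F z - W *v G z) \<partial>L))"
  have int_p: "integrable L (\<lambda>z. (F z $ 1 - G z $ 1)\<^sup>2)"
    by (rule integrable_const_bound[where B = 1]) (auto simp: abs_square_le_1 intro!: eventually_mono[OF AE])
  have int_m: "integrable L (\<lambda>z. (F z $ 1 + G z $ 1)\<^sup>2)"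
  proof (rule integrable_const_bound[where B = 4])
    show "AE z in L. norm ((F z $ 1 + G z $ 1)\<^sup>2) \<le> 4"
      using AE
    proof eventually_elim
      case (elim z)
      then have "(F z $ 1 + G z $ 1)\<^sup>2 \<le> 2\<^sup>2"
        by (intro power_mono) auto
      then show ?case by simp
    qed
  qed auto
  have p: "?h (mat 1) = sqrt (\<integral>z. (F z $ 1 - G z $ 1)\<^sup>2 \<partial>L)"
    using integral_outer_1[of L "\<lambda>z. F z - G z"] int_p by simp
  have m: "?h (- mat 1) = sqrt (\<integral>z. (F z $ 1 + G z $ 1)\<^sup>2 \<partial>L)"
    using integral_outer_1[of L "\<lambda>z. F z - - mat 1 *v G z"] int_m
    by (simp add: matrix_vector_mult_def mat_def)
  have "?h (mat 1) \<le> ?h (- mat 1)"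
    unfolding p m
    by (intro real_sqrt_le_mono integral_mono_AE int_p int_m)
       (auto intro!: square_diff_le_square_sum eventually_mono[OF AE])
  then have "(INF W\<in>{W :: real^1^1. orthogonal_matrix W}. ?h W) = ?h (mat 1)"
    by (rule INF_orthogonal_matrix_1)
  then show ?thesis
    unfolding p by simp
qed

lemma lift1_nth [simp]: "lift1 Y \<omega> $ i = Y \<omega>"
  by (simp add: lift1_def)

lemma lift1_measurable [measurable]:
  assumes "Y \<in> borel_measurable M"
  shows "lift1 Y \<in> borel_measurable M"
  using assms
  by (subst borel_measurable_euclidean_space) (simp add: Basis_vec_def inner_axis)

lemma d_MV_sq_lift1:
  assumes "prob_space M" and [measurable]: "U \<in> borel_measurable M" "V \<in> borel_measurable M"
    and U: "AE \<omega> in M. U \<omega> \<in> {0..1}" and V: "AE \<omega> in M. V \<omega> \<in> {0..1}"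
  shows "(d_MV M (lift1 U) (lift1 V))\<^sup>2 = (\<integral>\<omega>. (U \<omega> - V \<omega>)\<^sup>2 \<partial>M)"
proof -
  have "AE \<omega> in M. lift1 U \<omega> $ 1 \<in> {0..1} \<and> lift1 V \<omega> $ 1 \<in> {0..1}"
    using U V by eventually_elim simp
  from INF_sqrt_second_moment_1[OF \<open>prob_space M\<close> _ _ this] show ?thesis
    unfolding d_MV_def by simp
qed

lemma ind_d_MV_sq_lift1:
  assumes "prob_space M" and [measurable]: "U \<in> borel_measurable M" "V \<in> borel_measurable M"
    and U: "AE \<omega> in M. U \<omega> \<in> {0..1}" and V: "AE \<omega> in M. V \<omega> \<in> {0..1}"
  shows "(ind_d_MV M (lift1 U) (lift1 V))\<^sup>2 = (\<integral>z. (U (fst z) - V (snd z))\<^sup>2 \<partial>(M \<Otimes>\<^sub>M M))"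
proof -
  interpret M: prob_space M by fact
  interpret MM: pair_prob_space M M ..
  let ?MU = "distr M borel (lift1 U)" and ?MV = "distr M borel (lift1 V)"
  interpret MU: prob_space ?MU by (rule M.prob_space_distr) simp
  interpret MV: prob_space ?MV by (rule M.prob_space_distr) simp
  interpret UV: pair_prob_space ?MU ?MV ..
  let ?lift = "\<lambda>(x, y). (lift1 U x, lift1 V y)"
  have lift: "?lift \<in> M \<Otimes>\<^sub>M M \<rightarrow>\<^sub>M borel \<Otimes>\<^sub>M borel"
    by measurable
  have [measurable]: "(\<lambda>x :: real^1. x $ 1) \<in> borel_measurable borel"
    by (intro borel_measurable_continuous_onI continuous_intros)
  have product: "?MU \<Otimes>\<^sub>M ?MV = distr (M \<Otimes>\<^sub>M M) (borel \<Otimes>\<^sub>M borel) ?lift"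
    by (rule pair_measure_distr) (auto intro: MV.sigma_finite_measure_axioms)
  have "AE z in M \<Otimes>\<^sub>M M. U (fst z) \<in> {0..1} \<and> V (snd z) \<in> {0..1}"
  proof (rule MM.AE_pair_measure)
    show "AE x in M. AE y in M. U (fst (x, y)) \<in> {0..1} \<and> V (snd (x, y)) \<in> {0..1}"
      using U by eventually_elim (use V in auto)
  qed measurable
  then have unit: "AE z in ?MU \<Otimes>\<^sub>M ?MV. fst z $ 1 \<in> {0..1} \<and> snd z $ 1 \<in> {0..1}"
    unfolding product by (subst AE_distr_iff[OF lift]) (simp_all add: split_def)
  have "(ind_d_MV M (lift1 U) (lift1 V))\<^sup>2
      = (\<integral>z. (fst z $ 1 - snd z $ 1)\<^sup>2 \<partial>(?MU \<Otimes>\<^sub>M ?MV))"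
    unfolding ind_d_MV_def
    by (rule INF_sqrt_second_moment_1[OF UV.prob_space_axioms _ _ unit]) measurable
  also have "\<dots> = (\<integral>z. (U (fst z) - V (snd z))\<^sup>2 \<partial>(M \<Otimes>\<^sub>M M))"
    unfolding product by (subst integral_distr[OF lift]) (auto simp: split_def)
  finally show ?thesis .
qed

section \<open>Support of a law\<close>

text \<open>The complement of the support is covered by the null sets among countably many basic open
  sets.\<close>

lemma AE_in_law_support:
  assumes "prob_space M" and X: "X \<in> borel_measurable M"
  shows "AE \<omega> in M. X \<omega> \<in> law_support M X"
proof -
  interpret M: prob_space M by fact
  interpret D: prob_space "distr M borel X"
    using X by (rule M.prob_space_distr)
  obtain B :: "real set set" where B: "countable B" "topological_basis B"
    using ex_countable_basis by blast
  let ?null = "{U \<in> B. measure (distr M borel X) U = 0}"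
  have "AE x in distr M borel X. \<forall>U\<in>?null. x \<notin> U"
  proof (rule AE_ball_countable')
    fix U assume U: "U \<in> ?null"
    then have "U \<in> null_sets (distr M borel X)"
      using topological_basis_open[OF B(2)] by (auto simp: null_sets_def D.emeasure_eq_measure)
    then show "AE x in distr M borel X. x \<notin> U"
      by (rule AE_not_in)
  qed (use B in auto)
  then have "AE \<omega> in M. \<forall>U\<in>?null. X \<omega> \<notin> U"
    by (rule AE_distrD[OF X])
  then show ?thesis
  proof eventually_elim
    case (elim \<omega>)
    show ?case
      unfolding law_support_def
    proof (intro CollectI allI impI)
      fix V assume V: "open V" "X \<omega> \<in> V"
      obtain U where U: "U \<in> B" "X \<omega> \<in> U" "U \<subseteq> V"
        using topological_basisE[OF B(2) V] by metis
      have "0 < measure (distr M borel X) U"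
        using elim U by (auto simp: less_le)
      also have "\<dots> \<le> measure (distr M borel X) V"
        using U V by (intro D.finite_measure_mono) auto
      finally show "0 < measure (distr M borel X) V" .
    qed
  qed
qed

text \<open>Taking \<open>x = y\<close> in the condition \<open>x y \<le> 1\<close> on the support gives \<open>x\<^sup>2 \<le> 1\<close>.\<close>

lemma positive_scalar_lpp_AE_unit:
  assumes "positive_scalar_lpp M X"
  shows "AE \<omega> in M. X t \<omega> \<in> {0..1}"
proof -
  have "AE \<omega> in M. 0 \<le> X t \<omega>" "AE \<omega> in M. X t \<omega> \<in> law_support M (X t)"
    using assms AE_in_law_support unfolding positive_scalar_lpp_def by blast+
  then show ?thesis
  proof eventually_elim
    case (elim \<omega>)
    then have "(X t \<omega>)\<^sup>2 \<le> 1"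
      using assms unfolding positive_scalar_lpp_def by (simp add: power2_eq_square)
    then show ?case
      using elim by (simp add: abs_square_le_1)
  qed
qed

section \<open>Second moments of sums with few correlated pairs\<close>

text \<open>Expand the square: a pair outside \<open>B\<close> contributes \<open>0\<close> and any other pair at most \<open>1\<close>. The
  condition is on product moments, not covariances, so that \<open>B\<close> can also collect pairs of biased
  summands.\<close>

lemma (in prob_space) second_moment_le_card_correlated:
  assumes "finite I"
    and [measurable]: "\<And>i. i \<in> I \<Longrightarrow> random_variable borel (c i)"
    and bound: "AE \<xi> in M. \<forall>i\<in>I. \<bar>c i \<xi>\<bar> \<le> (1::real)"
    and uncorr: "\<And>i j. i \<in> I \<Longrightarrow> j \<in> I \<Longrightarrow> (i, j) \<notin> B \<Longrightarrow> expectation (\<lambda>\<xi>. c i \<xi> * c j \<xi>) = 0"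
    and B: "finite B" "card B \<le> b"
  shows "integrable M (\<lambda>\<xi>. (\<Sum>i\<in>I. c i \<xi>)\<^sup>2)"
    and "expectation (\<lambda>\<xi>. (\<Sum>i\<in>I. c i \<xi>)\<^sup>2) \<le> b"
proof -
  have le1: "AE \<xi> in M. \<bar>c i \<xi> * c j \<xi>\<bar> \<le> 1" if "i \<in> I" "j \<in> I" for i j
    using bound by eventually_elim (use that in \<open>auto simp: abs_mult intro!: mult_le_one\<close>)
  have int: "integrable M (\<lambda>\<xi>. c i \<xi> * c j \<xi>)" if "i \<in> I" "j \<in> I" for i j
    by (rule integrable_const_bound[where B = 1]) (use le1 that in auto)
  have prod_le: "expectation (\<lambda>\<xi>. c i \<xi> * c j \<xi>) \<le> (if (i, j) \<in> B then 1 else 0)"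
    if "i \<in> I" "j \<in> I" for i j
  proof -
    have "expectation (\<lambda>\<xi>. c i \<xi> * c j \<xi>) \<le> expectation (\<lambda>\<xi>. 1)"
      using le1[OF that] int[OF that] by (intro integral_mono_AE) (auto elim!: eventually_mono)
    then show ?thesis
      using uncorr[OF that] by (simp add: prob_space)
  qed
  have square: "(\<lambda>\<xi>. (\<Sum>i\<in>I. c i \<xi>)\<^sup>2) = (\<lambda>\<xi>. \<Sum>i\<in>I. \<Sum>j\<in>I. c i \<xi> * c j \<xi>)"
    by (simp add: power2_eq_square sum_product)
  show "integrable M (\<lambda>\<xi>. (\<Sum>i\<in>I. c i \<xi>)\<^sup>2)"
    unfolding square by (intro Bochner_Integration.integrable_sum int)
  have "expectation (\<lambda>\<xi>. (\<Sum>i\<in>I. c i \<xi>)\<^sup>2) = (\<Sum>i\<in>I. \<Sum>j\<in>I. expectation (\<lambda>\<xi>. c i \<xi> * c j \<xi>))"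
    unfolding square by (simp add: Bochner_Integration.integral_sum int)
  also have "\<dots> \<le> (\<Sum>i\<in>I. \<Sum>j\<in>I. if (i, j) \<in> B then 1 else 0)"
    by (intro sum_mono prod_le)
  also have "\<dots> = (\<Sum>z\<in>I \<times> I. if z \<in> B then 1 else 0)"
    by (simp add: sum.cartesian_product split_def)
  also have "\<dots> = real (card (I \<times> I \<inter> B))"
    using \<open>finite I\<close> by (simp add: sum.If_cases)
  also have "\<dots> \<le> real (card B)"
    using B by (simp add: card_mono)
  also have "\<dots> \<le> b" using B by simp
  finally show "expectation (\<lambda>\<xi>. (\<Sum>i\<in>I. c i \<xi>)\<^sup>2) \<le> b" .
qed

text \<open>The indices within one pair may coincide, as they do for unshuffled rows.\<close>

lemma (in prob_space) indep_var_of_disjoint_pairs: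
  assumes ind: "indep_vars (\<lambda>_. S) w I"
    and I: "{i, k} \<subseteq> I" "{j, l} \<subseteq> I" and disj: "{i, k} \<inter> {j, l} = {}"
    and f: "f \<in> S \<Otimes>\<^sub>M S \<rightarrow>\<^sub>M S'" and g: "g \<in> S \<Otimes>\<^sub>M S \<rightarrow>\<^sub>M S''"
  shows "indep_var S' (\<lambda>\<xi>. f (w i \<xi>, w k \<xi>)) S'' (\<lambda>\<xi>. g (w j \<xi>, w l \<xi>))"
proof -
  have *: "(\<lambda>v. h (v p, v r)) \<in> PiM {p, r} (\<lambda>_. S) \<rightarrow>\<^sub>M R"
    if "h \<in> S \<Otimes>\<^sub>M S \<rightarrow>\<^sub>M R" for h R and p r
    by (rule measurable_compose[OF _ that], measurable)
  have "indep_var S' ((\<lambda>v. f (v i, v k)) \<circ> (\<lambda>\<xi>. restrict (\<lambda>i. w i \<xi>) {i, k}))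
                  S'' ((\<lambda>v. g (v j, v l)) \<circ> (\<lambda>\<xi>. restrict (\<lambda>i. w i \<xi>) {j, l}))"
    by (rule indep_var_compose[OF indep_var_restrict[OF ind disj I] *[OF f] *[OF g]])
  then show ?thesis by (simp add: comp_def)
qed

section \<open>Matching a sample along a fixed permutation\<close>

locale unit_pair_sample = P: prob_space N + Q: prob_space M
  for N :: "'b measure" and M :: "'a measure" +
  fixes n :: nat and w :: "nat \<Rightarrow> 'b \<Rightarrow> 'a" and U V :: "'a \<Rightarrow> real"
  assumes indep: "P.indep_vars (\<lambda>_. M) w {1..n}"
    and law: "j \<in> {1..n} \<Longrightarrow> distr N M (w j) = M"
    and U [measurable]: "U \<in> borel_measurable M"
    and V [measurable]: "V \<in> borel_measurable M"
    and U_unit: "AE \<omega> in M. U \<omega> \<in> {0..1}"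
    and V_unit: "AE \<omega> in M. V \<omega> \<in> {0..1}"
begin

definition paired_mean :: real where
  "paired_mean = (\<integral>\<omega>. (U \<omega> - V \<omega>)\<^sup>2 \<partial>M)"

definition crossed_mean :: real where
  "crossed_mean = (\<integral>z. (U (fst z) - V (snd z))\<^sup>2 \<partial>(M \<Otimes>\<^sub>M M))"

definition sq_diff :: "nat \<Rightarrow> nat \<Rightarrow> 'b \<Rightarrow> real" where
  "sq_diff i k \<xi> = (U (w i \<xi>) - V (w k \<xi>))\<^sup>2"

lemma w_measurable: "j \<in> {1..n} \<Longrightarrow> w j \<in> N \<rightarrow>\<^sub>M M"
  using indep unfolding P.indep_vars_def by auto

lemma AE_sample_unit: "AE \<xi> in N. \<forall>j\<in>{1..n}. U (w j \<xi>) \<in> {0..1} \<and> V (w j \<xi>) \<in> {0..1}"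
proof (rule AE_ball_countable')
  fix j assume j: "j \<in> {1..n}"
  have "AE \<omega> in distr N M (w j). U \<omega> \<in> {0..1} \<and> V \<omega> \<in> {0..1}"
    unfolding law[OF j] using U_unit V_unit by eventually_elim auto
  then show "AE \<xi> in N. U (w j \<xi>) \<in> {0..1} \<and> V (w j \<xi>) \<in> {0..1}"
    by (rule AE_distrD[OF w_measurable[OF j]])
qed simp

lemma AE_sq_diff_unit: "AE \<xi> in N. \<forall>i\<in>{1..n}. \<forall>k\<in>{1..n}. sq_diff i k \<xi> \<in> {0..1}"
  using AE_sample_unit
proof eventually_elim
  case (elim \<xi>)
  have "\<bar>U (w i \<xi>) - V (w k \<xi>)\<bar> \<le> 1" if "i \<in> {1..n}" "k \<in> {1..n}" for i k
    using elim[rule_format, OF that(1)] elim[rule_format, OF that(2)] by auto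
  then show ?case by (simp add: sq_diff_def abs_square_le_1)
qed

lemma sq_diff_measurable [measurable]:
  "i \<in> {1..n} \<Longrightarrow> k \<in> {1..n} \<Longrightarrow> sq_diff i k \<in> borel_measurable N"
  unfolding sq_diff_def[abs_def]
  using measurable_compose[OF w_measurable U] measurable_compose[OF w_measurable V] by measurable

lemma sq_diff_integrable:
  "i \<in> {1..n} \<Longrightarrow> k \<in> {1..n} \<Longrightarrow> integrable N (sq_diff i k)"
  by (rule P.integrable_const_bound[where B = 1])
     (use AE_sq_diff_unit in \<open>auto elim!: eventually_mono\<close>)

lemma expectation_sq_diff_same:
  assumes i: "i \<in> {1..n}"
  shows "P.expectation (sq_diff i i) = paired_mean"
proof -
  have "paired_mean = (\<integral>\<omega>. (U \<omega> - V \<omega>)\<^sup>2 \<partial>distr N M (w i))"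
    unfolding paired_mean_def law[OF i] ..
  also have "\<dots> = P.expectation (sq_diff i i)"
    unfolding sq_diff_def using w_measurable[OF i] by (intro integral_distr) auto
  finally show ?thesis ..
qed

lemma expectation_sq_diff_different:
  assumes i: "i \<in> {1..n}" and k: "k \<in> {1..n}" and "i \<noteq> k"
  shows "P.expectation (sq_diff i k) = crossed_mean"
proof -
  note [measurable] = w_measurable[OF i] w_measurable[OF k]
  have "P.indep_var M (\<lambda>\<xi>. fst (w i \<xi>, w i \<xi>)) M (\<lambda>\<xi>. fst (w k \<xi>, w k \<xi>))"
    by (rule P.indep_var_of_disjoint_pairs[OF indep]) (use assms in auto)
  then have joint: "M \<Otimes>\<^sub>M M = distr N (M \<Otimes>\<^sub>M M) (\<lambda>\<xi>. (w i \<xi>, w k \<xi>))"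
    by (simp add: P.indep_var_distribution_eq law[OF i] law[OF k])
  have "crossed_mean = (\<integral>z. (U (fst z) - V (snd z))\<^sup>2 \<partial>distr N (M \<Otimes>\<^sub>M M) (\<lambda>\<xi>. (w i \<xi>, w k \<xi>)))"
    unfolding crossed_mean_def by (subst joint) rule
  also have "\<dots> = P.expectation (sq_diff i k)"
    unfolding sq_diff_def by (subst integral_distr) auto
  finally show ?thesis ..
qed

lemma expectation_sq_diff_unit:
  assumes "i \<in> {1..n}" "k \<in> {1..n}"
  shows "P.expectation (sq_diff i k) \<in> {0..1}"
proof -
  have "AE \<xi> in N. 0 \<le> sq_diff i k \<xi>" "AE \<xi> in N. sq_diff i k \<xi> \<le> 1"
    using AE_sq_diff_unit assms by (auto elim!: eventually_mono)
  then show ?thesis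
    using P.integral_le_const[OF sq_diff_integrable[OF assms]]
      P.integral_ge_const[OF sq_diff_integrable[OF assms]] by auto
qed

text \<open>The proof of the deviation bound for one permutation \<open>q\<close> counts the pairs \<open>(i, j)\<close> whose
  shifted summands can have a nonzero product moment. Fixed points of \<open>q\<close> in the shuffled block are
  biased, because they match a row with itself while \<open>crossed_mean\<close> is subtracted. Pairs of
  them are therefore correlated in the sense of second moments.\<close>

lemma matched_block_deviation:
  assumes a: "0 < a" "a < n" and q: "q permutes {n - a + 1..n}" and "0 < \<epsilon>"
  shows "P.prob {\<xi> \<in> space N. \<bar>(\<Sum>i=1..n. sq_diff i (q i) \<xi>) / real n
             - ((1 - real a / real n) * paired_mean + real a / real n * crossed_mean)\<bar> \<ge> \<epsilon>}
         \<le> (real n + 2 * real a + real a * real (card {i\<in>{n - a + 1..n}. q i = i}))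
            / (real n * \<epsilon>)\<^sup>2"
proof -
  let ?L = "{n - a + 1..n}"
  let ?Fix = "{i\<in>?L. q i = i}"
  let ?mean = "\<lambda>i. if i \<in> ?L then crossed_mean else paired_mean"
  let ?c = "\<lambda>i \<xi>. sq_diff i (q i) \<xi> - ?mean i"
  \<comment> \<open>The diagonal; the pairs that share a row because one index is the image of the other; and
      a superset of the pairs of biased summands. The cruder factor \<open>?L\<close> in the last part makes the
      count linear in the number of fixed points, so that its mean suffices later.\<close>
  let ?B = "(\<lambda>i. (i, i)) ` {1..n} \<union> ((\<lambda>i. (i, q i)) ` ?L \<union> ((\<lambda>j. (q j, j)) ` ?L \<union> ?Fix \<times> ?L))"
  have qI: "q i \<in> {1..n}" if "i \<in> {1..n}" for i
    using permutes_in_image[OF q, of i] permutes_not_in[OF q, of i] that by (cases "i \<in> ?L") auto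
  have q_head: "q i = i" if "i \<notin> ?L" for i
    using permutes_not_in[OF q that] .
  have q_inj: "q i = q j \<longleftrightarrow> i = j" for i j
    using permutes_inj[OF q] by (auto dest: injD)
  \<comment> \<open>Both constants are expectations of squared differences in \<open>[0, 1]\<close>; for \<open>crossed_mean\<close> this
      takes two distinct rows, which exist because \<open>1 < n\<close>.\<close>
  have mean_unit: "?mean i \<in> {0..1}" for i
    using expectation_sq_diff_unit[of 1 1] expectation_sq_diff_same[of 1]
      expectation_sq_diff_unit[of 1 n] expectation_sq_diff_different[of 1 n] a by auto
  have centred: "P.expectation (?c i) = 0" if "i \<in> {1..n}" "i \<notin> ?Fix" for i
  proof -
    have "P.expectation (sq_diff i (q i)) = ?mean i"
      using that expectation_sq_diff_same[of i] expectation_sq_diff_different[of i "q i"]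
        qI[of i] q_head[of i] by auto
    then show ?thesis
      using sq_diff_integrable[OF that(1) qI[OF that(1)]] by (simp add: P.prob_space)
  qed
  have uncorr: "P.expectation (\<lambda>\<xi>. ?c i \<xi> * ?c j \<xi>) = 0"
    if ij: "i \<in> {1..n}" "j \<in> {1..n}" "(i, j) \<notin> ?B" for i j
  proof -
    have "i \<noteq> j" using ij by auto
    \<comment> \<open>An index outside the block is its own image, so a clash there would put the pair on the
        diagonal.\<close>
    have "j \<noteq> q i"
      using ij \<open>i \<noteq> j\<close> q_head[of i] by (cases "i \<in> ?L") auto
    moreover have "i \<noteq> q j"
      using ij \<open>i \<noteq> j\<close> q_head[of j] by (cases "j \<in> ?L") auto
    ultimately have disj: "{i, q i} \<inter> {j, q j} = {}"
      using \<open>i \<noteq> j\<close> q_inj by auto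
    have f: "(\<lambda>z. (U (fst z) - V (snd z))\<^sup>2 - r) \<in> borel_measurable (M \<Otimes>\<^sub>M M)" for r
      by measurable
    have "P.indep_var borel (?c i) borel (?c j)"
      using P.indep_var_of_disjoint_pairs[OF indep _ _ disj f f, of "?mean i" "?mean j"] ij qI
      by (simp add: sq_diff_def)
    then have factor: "P.expectation (\<lambda>\<xi>. ?c i \<xi> * ?c j \<xi>) = P.expectation (?c i) * P.expectation (?c j)"
      using ij qI by (intro P.indep_var_lebesgue_integral)
        (auto intro!: Bochner_Integration.integrable_diff sq_diff_integrable)
    have "i \<notin> ?Fix \<or> j \<notin> ?Fix"
      using ij by auto
    then have "P.expectation (?c i) = 0 \<or> P.expectation (?c j) = 0"
      using centred[OF ij(1)] centred[OF ij(2)] by blast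
    then show ?thesis
      unfolding factor by (simp only: mult_eq_0_iff)
  qed
  have "card ?B \<le> card {1..n} + (card ?L + (card ?L + card (?Fix \<times> ?L)))"
    by (intro order.trans[OF card_Un_le] add_mono card_image_le order.refl) auto
  then have cardB: "card ?B \<le> n + 2 * a + a * card ?Fix"
    using a by (simp add: card_cartesian_product mult.commute)
  have bound: "AE \<xi> in N. \<forall>i\<in>{1..n}. \<bar>?c i \<xi>\<bar> \<le> 1"
    using AE_sq_diff_unit
  proof eventually_elim
    case (elim \<xi>)
    show ?case
    proof
      fix i assume "i \<in> {1..n}"
      then have "sq_diff i (q i) \<xi> \<in> {0..1}" using elim qI by blast
      then show "\<bar>?c i \<xi>\<bar> \<le> 1" using mean_unit[of i] unfolding atLeastAtMost_iff by arith
    qed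
  qed
  have meas: "?c i \<in> borel_measurable N" if "i \<in> {1..n}" for i
    using that qI by measurable
  note moment = P.second_moment_le_card_correlated[where c = ?c and B = ?B,
      OF finite_atLeastAtMost meas bound uncorr _ cardB]
  have sum_mean: "(\<Sum>i=1..n. ?mean i) = real a * crossed_mean + (real n - real a) * paired_mean"
  proof -
    have split: "{1..n} \<inter> {i. i \<in> ?L} = ?L" "{1..n} \<inter> - {i. i \<in> ?L} = {1..n - a}"
      using a by auto
    show ?thesis
      unfolding sum.If_cases[OF finite_atLeastAtMost] split using a by (simp add: of_nat_diff)
  qed
  have "{\<xi> \<in> space N. \<bar>(\<Sum>i=1..n. sq_diff i (q i) \<xi>) / real n
             - ((1 - real a / real n) * paired_mean + real a / real n * crossed_mean)\<bar> \<ge> \<epsilon>}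
        = {\<xi> \<in> space N. real n * \<epsilon> \<le> \<bar>\<Sum>i=1..n. ?c i \<xi>\<bar>}"
  proof -
    have "(\<Sum>i=1..n. sq_diff i (q i) \<xi>) / real n
             - ((1 - real a / real n) * paired_mean + real a / real n * crossed_mean)
          = (\<Sum>i=1..n. ?c i \<xi>) / real n" for \<xi>
      using a by (simp only: sum_subtractf sum_mean) (simp add: field_simps)
    then show ?thesis using a by (simp add: field_simps)
  qed
  moreover have "P.prob {\<xi> \<in> space N. real n * \<epsilon> \<le> \<bar>\<Sum>i=1..n. ?c i \<xi>\<bar>}
      \<le> P.expectation (\<lambda>\<xi>. (\<Sum>i=1..n. ?c i \<xi>)\<^sup>2) / (real n * \<epsilon>)\<^sup>2"
    using a \<open>0 < \<epsilon>\<close> meas by (intro P.second_moment_method moment(1) borel_measurable_sum) auto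
  moreover have "P.expectation (\<lambda>\<xi>. (\<Sum>i=1..n. ?c i \<xi>)\<^sup>2) / (real n * \<epsilon>)\<^sup>2
      \<le> real (n + 2 * a + a * card ?Fix) / (real n * \<epsilon>)\<^sup>2"
    by (intro divide_right_mono moment(2)) auto
  ultimately show ?thesis by simp
qed

end

section \<open>Averaging over a uniform shuffle\<close>

text \<open>Counting pairs \<open>(p, i)\<close> with \<open>p i = i\<close> by \<open>i\<close> instead of \<open>p\<close>: the permutations that fix \<open>i\<close>
  are those of \<open>S - {i}\<close>. Equivalently, a uniform permutation has one fixed point on average.\<close>

lemma sum_card_fixed_points:
  assumes "finite S" "S \<noteq> {}"
  shows "(\<Sum>p\<in>{p. p permutes S}. card {i\<in>S. p i = i}) = fact (card S)"
proof -
  have fixing: "card {p. p permutes S \<and> p i = i} = fact (card S - 1)" if "i \<in> S" for i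
  proof -
    have "{p. p permutes S \<and> p i = i} = {p. p permutes (S - {i})}"
      using that by (auto simp: permutes_def)
    then show ?thesis
      using assms that card_permutations[of "S - {i}" "card S - 1"] by simp
  qed
  have "(\<Sum>p\<in>{p. p permutes S}. card {i\<in>S. p i = i})
      = (\<Sum>i\<in>S. card {p\<in>{p. p permutes S}. p i = i})"
    using sum_multicount_gen[of "{p. p permutes S}" S "\<lambda>p i. p i = i"
        "\<lambda>i. card {p\<in>{p. p permutes S}. p i = i}"] assms finite_permutations[OF assms(1)] by simp
  also have "\<dots> = card S * fact (card S - 1)"
    using fixing by simp
  also have "\<dots> = fact (card S)"
    using assms by (simp add: fact_reduce card_gt_0_iff)
  finally show ?thesis .
qed

text \<open>The inverse appears because \<open>P e\<^sub>j = e\<^bsub>p j\<^esub>\<close> moves row \<open>j\<close> to position \<open>p j\<close>.\<close>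

lemma mat_mult_rows_perm_matrix:
  assumes "p permutes {1..n}" "i \<in> {1..n}"
  shows "mat_mult_rows n (perm_matrix p) Z i = Z (inv p i)"
proof -
  have "i = p j \<longleftrightarrow> j = inv p i" for j
    using permutes_inv_eq[OF assms(1), of i j] by metis
  then have "mat_mult_rows n (perm_matrix p) Z i = (\<Sum>j=1..n. if j = inv p i then Z j else 0)"
    unfolding mat_mult_rows_def perm_matrix_def
    by (intro sum.cong refl) simp
  also have "\<dots> = Z (inv p i)"
    using permutes_in_image[OF permutes_inv[OF assms(1)], of i] assms(2) by simp
  finally show ?thesis .
qed

text \<open>Conditioning on a uniform \<open>\<sigma>\<close> that is independent of \<open>g\<close>. The event \<open>E\<close> enters
  through an almost sure covering, so that it can be the deviation event itself, whose distances
  are infima over matrices that simplify only almost surely.\<close>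

lemma (in prob_space) prob_le_sum_prob_indep:
  assumes ind: "indep_elements M (count_space C) \<sigma> T g"
    and unif: "distr M (count_space C) \<sigma> = uniform_count_measure C" and C: "finite C"
    and A: "\<And>p. p \<in> C \<Longrightarrow> A p \<in> sets T"
    and E: "AE \<xi> in M. \<xi> \<in> E \<longrightarrow> g \<xi> \<in> A (\<sigma> \<xi>)"
  shows "prob E \<le> (\<Sum>p\<in>C. prob {\<xi> \<in> space M. g \<xi> \<in> A p}) / real (card C)"
proof -
  have \<sigma>: "\<sigma> \<in> M \<rightarrow>\<^sub>M count_space C" and g: "g \<in> M \<rightarrow>\<^sub>M T"
    and set: "indep_set (sets (vimage_algebra (space M) \<sigma> (count_space C)))
                        (sets (vimage_algebra (space M) g T))"
    using ind unfolding indep_elements_def by auto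
  let ?S = "\<lambda>p. \<sigma> -` {p} \<inter> space M"
  let ?G = "\<lambda>p. g -` A p \<inter> space M"
  have ev: "?S p \<in> events" "?G p \<in> events" if "p \<in> C" for p
    using measurable_sets[OF \<sigma>, of "{p}"] measurable_sets[OF g A[OF that]] that by auto
  have "prob E \<le> prob (\<Union>p\<in>C. ?S p \<inter> ?G p)"
  proof (rule finite_measure_mono_AE)
    show "AE \<xi> in M. \<xi> \<in> E \<longrightarrow> \<xi> \<in> (\<Union>p\<in>C. ?S p \<inter> ?G p)"
      using E AE_space by eventually_elim (use measurable_space[OF \<sigma>] in auto)
  qed (use ev C in auto)
  also have "\<dots> \<le> (\<Sum>p\<in>C. prob (?S p \<inter> ?G p))"
    using ev C by (intro finite_measure_subadditive_finite) auto
  also have "\<dots> = (\<Sum>p\<in>C. prob {\<xi> \<in> space M. g \<xi> \<in> A p} / real (card C))"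
  proof (rule sum.cong)
    fix p assume p: "p \<in> C"
    have "prob (?S p \<inter> ?G p) = prob (?S p) * prob (?G p)"
      using p A by (intro indep_setD[OF set] in_vimage_algebra) auto
    moreover have "prob (?S p) = measure (distr M (count_space C) \<sigma>) {p}"
      using p by (subst measure_distr[OF \<sigma>]) auto
    moreover have "\<dots> = 1 / real (card C)"
      unfolding unif using p C by (simp add: measure_uniform_count_measure)
    moreover have "?G p = {\<xi> \<in> space M. g \<xi> \<in> A p}" by auto
    ultimately show "prob (?S p \<inter> ?G p) = prob {\<xi> \<in> space M. g \<xi> \<in> A p} / real (card C)"
      by simp
  qed simp
  also have "\<dots> = (\<Sum>p\<in>C. prob {\<xi> \<in> space M. g \<xi> \<in> A p}) / real (card C)"
    by (simp add: sum_divide_distrib)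
  finally show ?thesis .
qed

text \<open>Split \<open>n + 3a = (n - a) + 4a\<close> and use \<open>n - a \<le> n\<close> and \<open>a \<le> n\<close>.\<close>

lemma variance_bound_split:
  fixes n a \<epsilon> :: real
  assumes "0 < a" "a < n" "0 < \<epsilon>"
  shows "(n + 3 * a) / (n * \<epsilon>)\<^sup>2 \<le> 1 / ((n - a) * \<epsilon>\<^sup>2) + 4 / (a * \<epsilon>\<^sup>2)"
proof -
  have head: "(n - a) / n\<^sup>2 \<le> 1 / (n - a)"
  proof -
    have "(n - a) / n\<^sup>2 \<le> (n - a) / ((n - a) * (n - a))"
      unfolding power2_eq_square using assms by (intro divide_left_mono mult_mono) auto
    then show ?thesis using assms by simp
  qed
  have tail: "4 * a / n\<^sup>2 \<le> 4 / a"
  proof -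
    have "4 * a / n\<^sup>2 \<le> 4 * a / (a * a)"
      unfolding power2_eq_square using assms by (intro divide_left_mono mult_mono) auto
    then show ?thesis using assms by simp
  qed
  have "(n + 3 * a) / (n * \<epsilon>)\<^sup>2 = ((n - a) + 4 * a) / n\<^sup>2 / \<epsilon>\<^sup>2"
    unfolding power_mult_distrib divide_divide_eq_left by simp
  also have "\<dots> = ((n - a) / n\<^sup>2 + 4 * a / n\<^sup>2) / \<epsilon>\<^sup>2"
    by (simp only: add_divide_distrib)
  also have "\<dots> \<le> (1 / (n - a) + 4 / a) / \<epsilon>\<^sup>2"
    using head tail by (intro divide_right_mono add_mono) auto
  also have "\<dots> = 1 / ((n - a) * \<epsilon>\<^sup>2) + 4 / (a * \<epsilon>\<^sup>2)"
    by (simp only: add_divide_distrib divide_divide_eq_left)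
  finally show ?thesis .
qed

theorem corollary1:
  fixes M :: "'a measure" and N :: "'b measure"
    and X :: "'t \<Rightarrow> 'a \<Rightarrow> real" and t s :: 't
    and w :: "nat \<Rightarrow> 'b \<Rightarrow> 'a" and \<sigma> :: "'b \<Rightarrow> nat \<Rightarrow> nat"
    and n \<alpha>\<^sub>n :: nat and \<alpha> \<epsilon> :: real
  assumes "0 < \<alpha>" and "\<alpha> \<le> 1"
    and "\<alpha>\<^sub>n = nat \<lfloor>\<alpha> * real n\<rfloor>"
    and "positive_scalar_lpp M X"
    and "iid_draws N M n w"
    and "uniform_shuffling N n \<alpha>\<^sub>n \<sigma>"
    and "indep_elements N (count_space (shuffles_of_last n \<alpha>\<^sub>n)) \<sigma>
           (latent_space n) (latent_positions n X w)"
    and "0 < \<epsilon>"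
  shows "ereal (\<P>(\<xi> in N.
            \<bar>dhat_MV_sq n (latent_matrix (X t) w \<xi>)
                (mat_mult_rows n (perm_matrix (\<sigma> \<xi>)) (latent_matrix (X s) w \<xi>))
              - ((1 - real \<alpha>\<^sub>n / real n) * (d_MV M (lift1 (X t)) (lift1 (X s)))\<^sup>2
                 + real \<alpha>\<^sub>n / real n * (ind_d_MV M (lift1 (X t)) (lift1 (X s)))\<^sup>2)\<bar> \<ge> \<epsilon>))
         \<le> 1 / ereal ((real n - real \<alpha>\<^sub>n) * \<epsilon>\<^sup>2)
           + 12 / ereal (real \<alpha>\<^sub>n * \<epsilon>\<^sup>2)
           + 4 / ereal (real \<alpha>\<^sub>n * \<epsilon>)"
proof (cases "0 < \<alpha>\<^sub>n \<and> \<alpha>\<^sub>n < n")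
  \<comment> \<open>A block is empty, and the corresponding term of the bound is infinite.\<close>
  case False
  have "\<alpha> * real n \<le> real n"
    using mult_right_mono[OF assms(2), of "real n"] by simp
  then have "\<alpha>\<^sub>n \<le> n"
    unfolding assms(3) by linarith
  then have "\<alpha>\<^sub>n = 0 \<or> real n - real \<alpha>\<^sub>n = 0"
    using False by auto
  then show ?thesis
    using assms(8) by (auto simp: divide_ereal_def)
next
  case True
  let ?a = "\<alpha>\<^sub>n" and ?C = "shuffles_of_last n \<alpha>\<^sub>n" and ?g = "latent_positions n X w"
  let ?L = "{n - ?a + 1..n}"
  interpret M: prob_space M using assms(4) unfolding positive_scalar_lpp_def by simp
  interpret N: prob_space N using assms(5) unfolding iid_draws_def by simp
  have X [measurable]: "X r \<in> borel_measurable M" for r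
    using assms(4) unfolding positive_scalar_lpp_def by simp
  have X_unit: "AE \<omega> in M. X r \<omega> \<in> {0..1}" for r
    using assms(4) by (rule positive_scalar_lpp_AE_unit)
  interpret unit_pair_sample N M n w "X t" "X s"
    using assms(5) X X_unit unfolding iid_draws_def by unfold_locales auto

  have paired: "(d_MV M (lift1 (X t)) (lift1 (X s)))\<^sup>2 = paired_mean"
    unfolding paired_mean_def by (rule d_MV_sq_lift1[OF M.prob_space_axioms X X X_unit X_unit])
  have crossed: "(ind_d_MV M (lift1 (X t)) (lift1 (X s)))\<^sup>2 = crossed_mean"
    unfolding crossed_mean_def by (rule ind_d_MV_sq_lift1[OF M.prob_space_axioms X X X_unit X_unit])

  let ?c = "(1 - real ?a / real n) * paired_mean + real ?a / real n * crossed_mean"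
  \<comment> \<open>The deviation event for a fixed permutation, as a set of latent positions: independence is
      available only for the pair \<open>\<sigma>\<close>, \<open>latent_positions n X w\<close>.\<close>
  let ?A = "\<lambda>p. {v \<in> space (latent_space n).
      \<epsilon> \<le> \<bar>(\<Sum>i=1..n. (v i t - v (inv p i) s)\<^sup>2) / real n - ?c\<bar>}"
  have perm: "p permutes ?L" "p permutes {1..n}" "inv p permutes ?L" "inv p permutes {1..n}"
    if "p \<in> ?C" for p
  proof -
    show *: "p permutes ?L" using that unfolding shuffles_of_last_def by simp
    then show **: "p permutes {1..n}" by (rule permutes_subset) auto
    show "inv p permutes ?L" "inv p permutes {1..n}"
      using * ** by (auto intro: permutes_inv)
  qed
  have inv_in: "inv p i \<in> {1..n}" if "p \<in> ?C" "i \<in> {1..n}" for p i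
    using permutes_in_image[OF perm(4)[OF that(1)], of i] that(2) by simp
  have C: "finite ?C" "card ?C = fact ?a"
    using True by (auto simp: shuffles_of_last_def finite_permutations card_permutations)

  have A: "?A p \<in> sets (latent_space n)" if p: "p \<in> ?C" for p
  proof -
    have coordinate: "(\<lambda>v. v i r) \<in> borel_measurable (latent_space n)" if "i \<in> {1..n}" for i and r :: 't
      unfolding latent_space_def
      by (rule measurable_compose[OF measurable_component_singleton[OF that]])
         (rule measurable_component_singleton, simp)
    have "(\<lambda>v. \<bar>(\<Sum>i=1..n. (v i t - v (inv p i) s)\<^sup>2) / real n - ?c\<bar>)
        \<in> borel_measurable (latent_space n)"
      using coordinate inv_in[OF p]
      by (intro borel_measurable_abs borel_measurable_diff borel_measurable_divide
          borel_measurable_sum borel_measurable_power borel_measurable_const) auto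
    then show ?thesis
      by (rule borel_measurable_le[OF borel_measurable_const])
  qed
  have g: "?g \<in> N \<rightarrow>\<^sub>M latent_space n"
    using assms(7) unfolding indep_elements_def by simp
  have g_sum: "(\<Sum>i=1..n. (?g \<xi> i t - ?g \<xi> (inv p i) s)\<^sup>2) = (\<Sum>i=1..n. sq_diff i (inv p i) \<xi>)"
    if "p \<in> ?C" for p \<xi>
    using inv_in[OF that] by (intro sum.cong) (auto simp: latent_positions_def sq_diff_def)

  let ?E = "{\<xi> \<in> space N. \<bar>dhat_MV_sq n (latent_matrix (X t) w \<xi>)
                (mat_mult_rows n (perm_matrix (\<sigma> \<xi>)) (latent_matrix (X s) w \<xi>))
              - ((1 - real ?a / real n) * (d_MV M (lift1 (X t)) (lift1 (X s)))\<^sup>2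
                 + real ?a / real n * (ind_d_MV M (lift1 (X t)) (lift1 (X s)))\<^sup>2)\<bar> \<ge> \<epsilon>}"
  have \<sigma>: "\<sigma> \<in> N \<rightarrow>\<^sub>M count_space ?C"
    and unif: "distr N (count_space ?C) \<sigma> = uniform_count_measure ?C"
    using assms(6) unfolding uniform_shuffling_def by auto
  have E: "AE \<xi> in N. \<xi> \<in> ?E \<longrightarrow> ?g \<xi> \<in> ?A (\<sigma> \<xi>)"
    using AE_sample_unit AE_space
  proof eventually_elim
    case (elim \<xi>)
    have p: "\<sigma> \<xi> \<in> ?C" using measurable_space[OF \<sigma> elim(2)] by simp
    have row: "mat_mult_rows n (perm_matrix (\<sigma> \<xi>)) (latent_matrix (X s) w \<xi>) i $ 1
        = X s (w (inv (\<sigma> \<xi>) i) \<xi>)" if "i \<in> {1..n}" for i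
      by (simp add: mat_mult_rows_perm_matrix[OF perm(2)[OF p] that] latent_matrix_def)
    have "dhat_MV_sq n (latent_matrix (X t) w \<xi>)
              (mat_mult_rows n (perm_matrix (\<sigma> \<xi>)) (latent_matrix (X s) w \<xi>))
          = (\<Sum>i=1..n. (latent_matrix (X t) w \<xi> i $ 1
               - mat_mult_rows n (perm_matrix (\<sigma> \<xi>)) (latent_matrix (X s) w \<xi>) i $ 1)\<^sup>2) / real n"
      using elim(1) row inv_in[OF p]
      by (intro dhat_MV_sq_nonneg_scalar) (auto simp: latent_matrix_def)
    also have "\<dots> = (\<Sum>i=1..n. sq_diff i (inv (\<sigma> \<xi>) i) \<xi>) / real n"
      by (intro arg_cong[where f = "\<lambda>x. x / real n"] sum.cong refl)
         (simp only: row, simp add: sq_diff_def latent_matrix_def)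
    finally have "dhat_MV_sq n (latent_matrix (X t) w \<xi>)
        (mat_mult_rows n (perm_matrix (\<sigma> \<xi>)) (latent_matrix (X s) w \<xi>))
        = (\<Sum>i=1..n. (?g \<xi> i t - ?g \<xi> (inv (\<sigma> \<xi>) i) s)\<^sup>2) / real n"
      by (simp only: g_sum[OF p])
    then show ?case
      using measurable_space[OF g elim(2)] by (simp add: paired crossed)
  qed

  have "N.prob ?E \<le> (\<Sum>p\<in>?C. N.prob {\<xi> \<in> space N. ?g \<xi> \<in> ?A p}) / real (card ?C)"
    by (rule N.prob_le_sum_prob_indep[where A = ?A, OF assms(7) unif C(1) A E])
  also have "\<dots> \<le> (\<Sum>p\<in>?C. (real n + 2 * real ?a + real ?a * real (card {i\<in>?L. p i = i}))
      / (real n * \<epsilon>)\<^sup>2) / real (card ?C)"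
  proof (intro divide_right_mono sum_mono)
    fix p assume p: "p \<in> ?C"
    have "{\<xi> \<in> space N. ?g \<xi> \<in> ?A p}
        = {\<xi> \<in> space N. \<epsilon> \<le> \<bar>(\<Sum>i=1..n. sq_diff i (inv p i) \<xi>) / real n - ?c\<bar>}"
      using measurable_space[OF g] g_sum[OF p] by auto
    moreover have "{i\<in>?L. inv p i = i} = {i\<in>?L. p i = i}"
      using permutes_inv_eq[OF perm(1)[OF p]] by metis
    ultimately show "N.prob {\<xi> \<in> space N. ?g \<xi> \<in> ?A p}
        \<le> (real n + 2 * real ?a + real ?a * real (card {i\<in>?L. p i = i})) / (real n * \<epsilon>)\<^sup>2"
      using matched_block_deviation[OF _ _ perm(3)[OF p] assms(8)] True by simp
  qed simp
  also have "\<dots> = (real n + 3 * real ?a) / (real n * \<epsilon>)\<^sup>2"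
  proof -
    have "(\<Sum>p\<in>?C. card {i\<in>?L. p i = i}) = fact (card ?L)"
      unfolding shuffles_of_last_def using True by (intro sum_card_fixed_points) auto
    also have "card ?L = ?a"
      using True by simp
    finally have "real (\<Sum>p\<in>?C. card {i\<in>?L. p i = i}) = real (fact ?a)"
      by (rule arg_cong)
    then have fixed: "(\<Sum>p\<in>?C. real (card {i\<in>?L. p i = i})) = fact ?a"
      by (simp only: of_nat_sum of_nat_fact)
    have "(\<Sum>p\<in>?C. real n + 2 * real ?a + real ?a * real (card {i\<in>?L. p i = i}))
        = fact ?a * (real n + 2 * real ?a) + real ?a * fact ?a"
      by (simp only: sum.distrib sum_constant sum_distrib_left[symmetric] fixed C of_nat_fact)
         (simp add: algebra_simps)
    also have "\<dots> = fact ?a * (real n + 3 * real ?a)"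
      by (simp add: algebra_simps)
    finally show ?thesis
      unfolding sum_divide_distrib[symmetric] C by simp
  qed
  also have "\<dots> \<le> 1 / ((real n - real ?a) * \<epsilon>\<^sup>2) + 4 / (real ?a * \<epsilon>\<^sup>2)"
    using True assms(8) by (intro variance_bound_split) auto
  also have "\<dots> \<le> 1 / ((real n - real ?a) * \<epsilon>\<^sup>2) + 12 / (real ?a * \<epsilon>\<^sup>2) + 4 / (real ?a * \<epsilon>)"
  proof -
    have "4 / (real ?a * \<epsilon>\<^sup>2) \<le> 12 / (real ?a * \<epsilon>\<^sup>2)" "0 \<le> 4 / (real ?a * \<epsilon>)"
      using True assms(8) by (auto intro!: divide_right_mono)
    then show ?thesis by linarith
  qed
  finally have "ereal (N.prob ?E) \<le> ereal (1 / ((real n - real ?a) * \<epsilon>\<^sup>2)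
      + 12 / (real ?a * \<epsilon>\<^sup>2) + 4 / (real ?a * \<epsilon>))"
    by simp
  then show ?thesis
    using True assms(8) by (simp add: one_ereal_def)
qed

end
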